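(* Let $\eta\in\mathbb{R}$ and consider a $T$-module with parameter $\eta$: a quadrotor module whose four rotors are located at positions $\boldsymbol{p}_1,\boldsymbol{p}_2,\boldsymbol{p}_3,\boldsymbol{p}_4\in\mathbb{R}^3$, which are the vertices of a (nondegenerate) square in the $xy$-plane centered at the origin of the module frame, and whose $j$-th rotor orientation $\boldsymbol{R}_j\in\mathsf{SO}(3)$ is the rotation by angle $\eta_j$ about the axis $\boldsymbol{p}_j$, where $\eta_1=\eta_3=\eta$ and $\eta_2=\eta_4=-\eta$. Then the module is torque-balanced; that is, when every rotor generates unit thrust ($\boldsymbol{u}=(1,1,1,1)^\top$), the total torque generated by the module is zero: $$\boldsymbol{\tau}=\sum_{j=1}^4\left(\boldsymbol{p}_j\times \boldsymbol{R}_j\hat{\boldsymbol z}+(-1)^j\frac{k_m}{k_f}\,\boldsymbol{R}_j\hat{\boldsymbol z}\right)=\boldsymbol{0}.$$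
   Context: Let $\hat{\boldsymbol z}=[0,0,1]^\top$. A module is a quadrotor with a module frame whose origin is at its center of mass; its four rotors $j=1,\dots,4$ lie in the $xy$-plane of that frame in a square configuration, at positions $\boldsymbol{p}_j$ (the "arm vectors"). Rotor $j$ has a rotor frame whose orientation in the module frame is $\boldsymbol{R}_j\in\mathsf{SO}(3)$ and whose $z$-axis $\boldsymbol{R}_j\hat{\boldsymbol z}$ is the direction of the rotor force. With thrust magnitude $f_j\ge 0$, rotor $j$ produces the force $\boldsymbol{f}_j=f_j\boldsymbol{R}_j\hat{\boldsymbol z}$ and the air-drag torque $(-1)^j\frac{k_m}{k_f}f_j\boldsymbol{R}_j\hat{\boldsymbol z}$, where $k_f,k_m>0$ are constants. The total torque of the module is $$\boldsymbol{\tau}=\sum_{j=1}^4\left(\boldsymbol{p}_j\times\boldsymbol{f}_j+(-1)^j\frac{k_m}{k_f}f_j\boldsymbol{R}_j\hat{\boldsymbol z}\right),$$ and the input vector is $\boldsymbol{u}=[f_1,f_2,f_3,f_4]^\top$. Torque-balanced module: a module such that $\boldsymbol{u}=\boldsymbol{1}$ implies $\boldsymbol{\tau}=\boldsymbol{0}$. $T$-module: a module whose rotor $j$ is tilted by an angle $\eta_j$ around its arm vector $\boldsymbol{p}_j$, $j=1,\dots,4$, from the vertical direction $\hat{\boldsymbol z}$ (i.e. $\boldsymbol{R}_j$ is the rotation by $\eta_j$ about the axis $\boldsymbol{p}_j$, right-hand rule), with $\eta_1=\eta_3=-\eta_2=-\eta_4$; its parameter is $\eta=\eta_1$. *)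

theory Defs
  imports "HOL-Analysis.Analysis"
begin

definition zhat :: "real^3" where
  "zhat = vector [0, 0, 1]"

text \<open>
  Rotation about a nonzero axis, in the right-hand sense: vectors orthogonal to the axis are
  rotated counterclockwise when seen from the tip of the axis, since
  \<open>v\<close>, \<open>cross3 (sgn a) v\<close>, \<open>sgn a\<close> is then a right-handed orthogonal frame
  (\<open>sgn a\<close> is the unit vector along \<open>a\<close>, and \<open>rotation_matrix\<close> is membership in SO(3)).
\<close>
definition rotation_about :: "real^3 \<Rightarrow> real \<Rightarrow> real^3^3 \<Rightarrow> bool" where
  "rotation_about a \<theta> R \<longleftrightarrow>
     a \<noteq> 0 \<and> rotation_matrix R \<and> R *v a = a \<and>
     (\<forall>v. a \<bullet> v = 0 \<longrightarrow> R *v v = cos \<theta> *\<^sub>R v + sin \<theta> *\<^sub>R cross3 (sgn a) v)"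

text \<open>Nondegenerate square, vertices listed in cyclic order.\<close>
definition is_square :: "real^3 \<Rightarrow> real^3 \<Rightarrow> real^3 \<Rightarrow> real^3 \<Rightarrow> bool" where
  "is_square a b c d \<longleftrightarrow>
     a \<noteq> b \<and> c - b = d - a \<and> (b - a) \<bullet> (d - a) = 0 \<and> norm (b - a) = norm (d - a)"

text \<open>
  Rotors are indexed by \<open>j \<in> {1..4}\<close>; values of the index functions elsewhere are irrelevant.
\<close>
record quadrotor =
  pos :: "nat \<Rightarrow> real^3"
  orient :: "nat \<Rightarrow> real^3^3"
  thrust_coeff :: real
  drag_coeff :: real

text \<open>
  The permutation \<open>\<sigma>\<close> leaves the labelling of the vertices arbitrary: consecutive
  rotor numbers need not be adjacent vertices.  The centre of the square is its centroid.
\<close>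
definition quadrotor_module :: "quadrotor \<Rightarrow> bool" where
  "quadrotor_module M \<longleftrightarrow>
     thrust_coeff M > 0 \<and> drag_coeff M > 0 \<and>
     (\<forall>j\<in>{1..4}. pos M j $ 3 = 0) \<and>
     (\<exists>\<sigma>. \<sigma> permutes {1..4} \<and>
        is_square (pos M (\<sigma> 1)) (pos M (\<sigma> 2)) (pos M (\<sigma> 3)) (pos M (\<sigma> 4))) \<and>
     (1/4) *\<^sub>R (\<Sum>j=1..4. pos M j) = 0 \<and>
     (\<forall>j\<in>{1..4}. rotation_matrix (orient M j))"

definition rotor_force :: "quadrotor \<Rightarrow> (nat \<Rightarrow> real) \<Rightarrow> nat \<Rightarrow> real^3" where
  "rotor_force M u j = u j *\<^sub>R (orient M j *v zhat)"

definition rotor_drag :: "quadrotor \<Rightarrow> (nat \<Rightarrow> real) \<Rightarrow> nat \<Rightarrow> real^3" where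
  "rotor_drag M u j =
     ((-1) ^ j * (drag_coeff M / thrust_coeff M) * u j) *\<^sub>R (orient M j *v zhat)"

definition total_torque :: "quadrotor \<Rightarrow> (nat \<Rightarrow> real) \<Rightarrow> real^3" where
  "total_torque M u = (\<Sum>j=1..4. cross3 (pos M j) (rotor_force M u j) + rotor_drag M u j)"

definition torque_balanced :: "quadrotor \<Rightarrow> bool" where
  "torque_balanced M \<longleftrightarrow>
     (\<forall>u. (\<forall>j\<in>{1..4}. u j = 1) \<longrightarrow> total_torque M u = 0)"

definition T_module :: "real \<Rightarrow> quadrotor \<Rightarrow> bool" where
  "T_module \<eta> M \<longleftrightarrow> quadrotor_module M \<and>
     (\<exists>\<theta> :: nat \<Rightarrow> real.
        \<theta> 1 = \<eta> \<and> \<theta> 3 = \<eta> \<and> \<theta> 2 = - \<eta> \<and> \<theta> 4 = - \<eta> \<and>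
        (\<forall>j\<in>{1..4}. rotation_about (pos M j) (\<theta> j) (orient M j)))"

end

theory Submission
  imports Defs
begin

text \<open>
  Each thrust direction is \<open>cos \<eta> z + sin \<eta>\<^sub>j (sgn p\<^sub>j \<times> z)\<close>. The arm vectors sum to zero and have a
  common length \<open>r\<close>, so the arm torques contribute \<open>cos \<eta> (\<Sum> p\<^sub>j) \<times> z - r (\<Sum> sin \<eta>\<^sub>j) z = 0\<close>.
  In the drag torques the vertical parts cancel in pairs, and since \<open>(-1)^j sin \<eta>\<^sub>j = - sin \<eta>\<close> for
  every rotor, the horizontal parts again add up to a multiple of \<open>(\<Sum> p\<^sub>j) \<times> z\<close>.
\<close>

text \<open>The parallelogram condition and the zero sum make opposite vertices antipodal,
  \<open>c = - a\<close> and \<open>d = - b\<close>. Orthogonality of adjacent sides then reads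
  \<open>(b - a) \<bullet> (- b - a) = 0\<close>, which is equality of the squared norms of
  \<open>a\<close> and \<open>b\<close>.\<close>

lemma is_square_centred_norm_eq:
  assumes "is_square a b c d" and "a + b + c + d = 0"
  shows "norm b = norm a" and "norm c = norm a" and "norm d = norm a"
proof -
  have "c = b + d - a"
    using assms(1) by (simp add: is_square_def algebra_simps)
  with assms(2) have "2 *\<^sub>R (b + d) = 0"
    by (simp add: algebra_simps scaleR_2)
  then have d: "d = - b"
    by (simp add: eq_neg_iff_add_eq_0 add.commute)
  with \<open>c = b + d - a\<close> have c: "c = - a"
    by simp
  have "(b - a) \<bullet> (- b - a) = 0"
    using assms(1) d by (simp add: is_square_def)
  then have "b \<bullet> b = a \<bullet> a"
    by (simp add: inner_diff_left inner_diff_right inner_commute)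
  then show "norm b = norm a"
    by (simp add: norm_eq_sqrt_inner)
  then show "norm c = norm a" and "norm d = norm a"
    by (simp_all add: c d)
qed

lemma sum_upto_4:
  fixes f :: "nat \<Rightarrow> 'a::comm_monoid_add"
  shows "(\<Sum>j=1..4. f j) = f 1 + f 2 + f 3 + f 4"
  by (simp add: numeral_eq_Suc add.assoc)

lemma quadrotor_module_sum_pos:
  assumes "quadrotor_module M"
  shows "(\<Sum>j=1..4. pos M j) = 0"
  using assms by (simp add: quadrotor_module_def)

text \<open>The zero sum survives relabelling by \<open>\<sigma>\<close>, so the centred square
  lemma applies to the cyclic order; surjectivity of \<open>\<sigma>\<close> carries the common
  length back to every rotor number.\<close>

lemma quadrotor_module_norm_pos_eq:
  assumes "quadrotor_module M"
  shows "\<exists>r. \<forall>j\<in>{1..4}. norm (pos M j) = r"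
proof -
  obtain \<sigma> where \<sigma>: "\<sigma> permutes {1..4}"
    and sq: "is_square (pos M (\<sigma> 1)) (pos M (\<sigma> 2)) (pos M (\<sigma> 3)) (pos M (\<sigma> 4))"
    using assms by (auto simp: quadrotor_module_def)
  have "(\<Sum>i=1..4. pos M (\<sigma> i)) = 0"
    using sum.permute[OF \<sigma>, of "pos M"] quadrotor_module_sum_pos[OF assms] by (simp add: o_def)
  then have "pos M (\<sigma> 1) + pos M (\<sigma> 2) + pos M (\<sigma> 3) + pos M (\<sigma> 4) = 0"
    by (simp only: sum_upto_4)
  note norms = is_square_centred_norm_eq[OF sq this]
  have "norm (pos M j) = norm (pos M (\<sigma> 1))" if j: "j \<in> {1..4}" for j
  proof -
    from j obtain i where "i \<in> {1..4}" and i: "j = \<sigma> i"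
      using permutes_image[OF \<sigma>] by (metis imageE)
    then have "i = 1 \<or> i = 2 \<or> i = 3 \<or> i = 4"
      by auto
    with norms i show ?thesis
      by auto
  qed
  then show ?thesis
    by blast
qed

text \<open>A horizontal axis is orthogonal to \<open>zhat\<close>, so the defining clause for
  orthogonal vectors applies; the factor \<open>1 / norm p\<close> comes from
  \<open>sgn p\<close>.\<close>

lemma rotation_about_horizontal_zhat:
  assumes "rotation_about p \<theta> R" and "p $ 3 = 0"
  shows "R *v zhat = cos \<theta> *\<^sub>R zhat + (sin \<theta> / norm p) *\<^sub>R cross3 p zhat"
proof -
  have "p \<bullet> zhat = 0"
    using assms(2) by (simp add: zhat_def inner_vec_def sum_3 vector_3)
  then show ?thesis
    using assms(1) by (simp add: rotation_about_def sgn_div_norm cross_mult_left divide_inverse)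
qed

text \<open>This is the triple product expansion \<open>(p \<bullet> zhat) *\<^sub>R p - (p
  \<bullet> p) *\<^sub>R zhat\<close>, whose first term vanishes for horizontal
  \<open>p\<close>.\<close>

lemma cross3_horizontal_zhat:
  assumes "p $ 3 = 0"
  shows "cross3 p (cross3 p zhat) = - ((norm p)\<^sup>2 *\<^sub>R zhat)"
  using assms
  by (simp add: vec_eq_iff forall_3 cross3_def zhat_def vector_3 power2_norm_eq_inner
      inner_vec_def sum_3)

text \<open>The ratio of drag to thrust can be an arbitrary \<open>k\<close> because arm torques and
  drag torques cancel separately.\<close>

lemma T_module_unit_torque_eq_0:
  assumes "T_module \<eta> M"
  shows "(\<Sum>j=1..4. cross3 (pos M j) (orient M j *v zhat)
    + ((-1) ^ j * k) *\<^sub>R (orient M j *v zhat)) = 0"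
proof -
  have M: "quadrotor_module M"
    using assms by (simp add: T_module_def)
  obtain \<theta> where \<theta>: "\<theta> 1 = \<eta>" "\<theta> 2 = - \<eta>" "\<theta> 3 = \<eta>" "\<theta> 4 = - \<eta>"
    and rot: "\<And>j. j \<in> {1..4} \<Longrightarrow> rotation_about (pos M j) (\<theta> j) (orient M j)"
    using assms by (auto simp: T_module_def)
  obtain r where r: "\<And>j. j \<in> {1..4} \<Longrightarrow> norm (pos M j) = r"
    using quadrotor_module_norm_pos_eq[OF M] by auto
  define P where "P j = cross3 (pos M j) zhat" for j
  have "(\<Sum>j=1..4. P j) = cross3 (\<Sum>j=1..4. pos M j) zhat"
    by (simp only: sum_upto_4 P_def cross_add_left)
  also have "\<dots> = 0"
    by (simp add: quadrotor_module_sum_pos[OF M] flip: One_nat_def)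
  \<comment> \<open>Solved for \<open>P 4\<close>, the zero sum serves as a rewrite rule that
    eliminates one of the four vectors.\<close>
  finally have P_sum: "P 4 = - P 1 - P 2 - P 3"
    unfolding sum_upto_4 by (simp add: eq_neg_iff_add_eq_0 algebra_simps)
  have summand: "cross3 (pos M j) (orient M j *v zhat) + ((-1) ^ j * k) *\<^sub>R (orient M j *v zhat)
    = cos (\<theta> j) *\<^sub>R P j - (r * sin (\<theta> j)) *\<^sub>R zhat
      + ((-1) ^ j * k) *\<^sub>R (cos (\<theta> j) *\<^sub>R zhat + (sin (\<theta> j) / r) *\<^sub>R P j)"
    if j: "j \<in> {1..4}" for j
  proof -
    have z: "pos M j $ 3 = 0"
      using M j by (simp add: quadrotor_module_def)
    have "orient M j *v zhat = cos (\<theta> j) *\<^sub>R zhat + (sin (\<theta> j) / r) *\<^sub>R P j"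
      using rotation_about_horizontal_zhat[OF rot[OF j] z] r[OF j] by (simp add: P_def)
    moreover have "cross3 (pos M j) (P j) = - (r\<^sup>2 *\<^sub>R zhat)"
      using cross3_horizontal_zhat[OF z] r[OF j] by (simp add: P_def)
    \<comment> \<open>One factor of \<open>r\<^sup>2\<close> cancels against
      \<open>sin (\<theta> j) / r\<close>; with division by zero equal to 0 this is valid for every
      real \<open>r\<close>.\<close>
    ultimately show ?thesis
      by (simp add: cross_add_right cross_mult_right power2_eq_square mult.commute flip: P_def)
  qed
  show ?thesis
    \<comment> \<open>With the angles inserted, the sum is a linear combination of
      \<open>P 1\<close>, \<open>P 2\<close>, \<open>P 3\<close> and \<open>zhat\<close> in which
      all coefficients are zero.\<close>
    by (subst sum.cong[OF refl summand], assumption)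
      (simp only: sum_upto_4, simp add: \<theta> P_sum algebra_simps del: One_nat_def)
qed

theorem proposition1:
  fixes \<eta> :: real and M :: quadrotor
  assumes "T_module \<eta> M"
  shows "torque_balanced M \<and>
    (\<Sum>j=1..4. cross3 (pos M j) (orient M j *v zhat)
       + ((-1) ^ j * (drag_coeff M / thrust_coeff M)) *\<^sub>R (orient M j *v zhat)) = 0"
proof (rule conjI)
  note torque = T_module_unit_torque_eq_0[OF assms, of "drag_coeff M / thrust_coeff M"]
  then show "(\<Sum>j=1..4. cross3 (pos M j) (orient M j *v zhat)
       + ((-1) ^ j * (drag_coeff M / thrust_coeff M)) *\<^sub>R (orient M j *v zhat)) = 0" .
  show "torque_balanced M"
    unfolding torque_balanced_def
  proof (intro allI impI)
    fix u :: "nat \<Rightarrow> real"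
    assume u: "\<forall>j\<in>{1..4}. u j = 1"
    have "total_torque M u = (\<Sum>j=1..4. cross3 (pos M j) (orient M j *v zhat)
       + ((-1) ^ j * (drag_coeff M / thrust_coeff M)) *\<^sub>R (orient M j *v zhat))"
      unfolding total_torque_def
      by (rule sum.cong) (simp_all add: rotor_force_def rotor_drag_def u)
    with torque show "total_torque M u = 0"
      by simp
  qed
qed

end
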